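(* For every $k$-copula $C$, its support $\operatorname{supp} C$ is $1$-essentially closed.
   Context: Let $k$ be a positive integer. A $k$-copula is a function $C\colon [0,1]^k \to [0,1]$ such that (i) $C(u_1,\dots,u_{i-1},0,u_{i+1},\dots,u_k)=0$; (ii) $C(1,\dots,1,u_i,1,\dots,1)=u_i$; (iii) $C$ is $k$-increasing: for each hyperrectangle $B=\prod_{i=1}^k [x_i,y_i]\subseteq[0,1]^k$, $V_C(B)=\sum_{z\in\prod_{i=1}^k\{x_i,y_i\}}(-1)^{N(z)}C(z)\ge 0$, where $N(z)$ is the size of $\{i\colon z_i=x_i\}$. The set function $V_C$ extends uniquely to a Borel probability measure on $[0,1]^k$, also denoted $V_C$ (each of its one-dimensional coordinate marginals is Lebesgue measure on $[0,1]$). The support $\operatorname{supp} C$ is the topological support of the measure $V_C$, i.e. the set of points $x$ all of whose open neighborhoods $G$ satisfy $V_C(G)>0$ (meaning $V_C(G\cap[0,1]^k)>0$ for $G$ open in $\mathbb{R}^k$). A standard subspace of $\mathbb{R}^k$ is a subspace spanned by standard basis vectors. $\lambda_d$ and $\lambda_d^*$ denote $d$-dimensional Lebesgue measure and outer measure (a $d$-dimensional standard subspace being identified with $\mathbb{R}^d$), with $\lambda_0=\lambda_0^*$ the counting measure. $\pi_W$ is the orthogonal projection onto $W$. For $A\subseteq\mathbb{R}^k$ and an integer $0\le d\le k$, the $d$-essential closure $\widehat{A}^{d}$ of $A$ is the set of all $x\in\mathbb{R}^k$ such that for every open neighborhood $G$ of $x$ there exists a $d$-dimensional standard subspace $W$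 with $\lambda_d^*(\pi_W(G\cap A))>0$. The set $A$ is $d$-essentially closed if $A=\widehat{A}^{d}$. *)

theory Defs
  imports "HOL-Probability.Probability"
begin

section \<open>Copulas and their supports\<close>

text \<open>
  The dimension k is the cardinality of the index type \<^typ>\<open>'k\<close>.  A copula is a total function on
  \<^typ>\<open>real^'k\<close> of which only the values on the unit cube \<^term>\<open>cbox 0 1\<close> are relevant.
\<close>

text \<open>
  The sum ranges over the set of vertices of the box, hence is the usual volume only for
  nondegenerate boxes (for a degenerate box the vertices coincide and do not cancel).  It is
  therefore only used for boxes with \<open>x $ i < y $ i\<close> in every coordinate.  This is spelled out below
  because \<open><\<close> on vectors is not the coordinatewise strict order.
\<close>

definition box_vertices :: "real^'k \<Rightarrow> real^'k \<Rightarrow> (real^'k) set" where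
  "box_vertices x y = {z. \<forall>i. z $ i \<in> {x $ i, y $ i}}"

definition box_volume :: "(real^'k \<Rightarrow> real) \<Rightarrow> real^'k \<Rightarrow> real^'k \<Rightarrow> real" where
  "box_volume C x y = (\<Sum>z\<in>box_vertices x y. (-1) ^ card {i. z $ i = x $ i} * C z)"

definition unit_subbox :: "real^'k \<Rightarrow> real^'k \<Rightarrow> bool" where
  "unit_subbox x y \<longleftrightarrow> (\<forall>i. 0 \<le> x $ i \<and> x $ i < y $ i \<and> y $ i \<le> 1)"

definition copula :: "(real^'k \<Rightarrow> real) \<Rightarrow> bool" where
  "copula C \<longleftrightarrow>
     C ` cbox 0 1 \<subseteq> {0..1} \<and>
     (\<forall>u\<in>cbox 0 1. \<forall>i. u $ i = 0 \<longrightarrow> C u = 0) \<and>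
     (\<forall>u\<in>cbox 0 1. \<forall>i. (\<forall>j. j \<noteq> i \<longrightarrow> u $ j = 1) \<longrightarrow> C u = u $ i) \<and>
     (\<forall>x y. unit_subbox x y \<longrightarrow> box_volume C x y \<ge> 0)"

definition is_copula_measure :: "(real^'k \<Rightarrow> real) \<Rightarrow> (real^'k) measure \<Rightarrow> bool" where
  "is_copula_measure C M \<longleftrightarrow>
     sets M = sets (restrict_space borel (cbox 0 1)) \<and>
     prob_space M \<and>
     (\<forall>x y. unit_subbox x y \<longrightarrow> measure M (cbox x y) = box_volume C x y)"

definition copula_measure :: "(real^'k \<Rightarrow> real) \<Rightarrow> (real^'k) measure" where
  "copula_measure C = (THE M. is_copula_measure C M)"

definition copula_support :: "(real^'k \<Rightarrow> real) \<Rightarrow> (real^'k) set" where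
  "copula_support C =
     {x. \<forall>G. open G \<and> x \<in> G \<longrightarrow> emeasure (copula_measure C) (G \<inter> cbox 0 1) > 0}"


section \<open>Essential closure\<close>

definition standard_subspace :: "(real^'k) set \<Rightarrow> bool" where
  "standard_subspace W \<longleftrightarrow> (\<exists>I. W = span ((\<lambda>i. axis i 1) ` I))"

definition orth_projection :: "(real^'k) set \<Rightarrow> real^'k \<Rightarrow> real^'k" where
  "orth_projection W x = (THE p. p \<in> W \<and> (\<forall>w\<in>W. orthogonal (x - p) w))"

text \<open>
  A standard subspace \<open>W\<close> of dimension d is identified with the product of d copies of the reals,
  indexed by the coordinates \<open>i\<close> whose basis vector lies in \<open>W\<close>.  For d = 0 the product measure is the
  point mass on a one-point space, that is, counting measure.
\<close>

definition subspace_coords :: "(real^'k) set \<Rightarrow> 'k set" where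
  "subspace_coords W = {i. axis i 1 \<in> W}"

definition subspace_outer_lebesgue :: "(real^'k) set \<Rightarrow> (real^'k) set \<Rightarrow> ennreal" where
  "subspace_outer_lebesgue W S =
     outer_measure_of (Pi\<^sub>M (subspace_coords W) (\<lambda>_. lborel))
       ((\<lambda>x. restrict (\<lambda>i. x $ i) (subspace_coords W)) ` S)"

definition essential_closure :: "nat \<Rightarrow> (real^'k) set \<Rightarrow> (real^'k) set" where
  "essential_closure d A =
     {x. \<forall>G. open G \<and> x \<in> G \<longrightarrow>
           (\<exists>W. standard_subspace W \<and> dim W = d \<and>
                subspace_outer_lebesgue W (orth_projection W ` (G \<inter> A)) > 0)}"

definition essentially_closed :: "nat \<Rightarrow> (real^'k) set \<Rightarrow> bool" where
  "essentially_closed d A \<longleftrightarrow> A = essential_closure d A"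

end

theory Submission
  imports Defs
begin

text \<open>
  One-dimensional margins of the copula measure are uniform, so the preimage of a Lebesgue null set
  under a coordinate is null for the copula measure.  If the part of the support inside an open set
  \<open>G\<close> had a null projection to some axis, \<open>G\<close> itself would be null, because the complement of the
  support is null (Lindeloef).  This gives one inclusion; the other holds because the support is closed.

  Since the copula measure is given by a definite description, its existence has to be proved.
  The volumes of the dyadic cells of generation \<open>n\<close> define a discrete law on the upper corners of the
  cells, and rounding up to a coarser generation maps these laws to each other.  By Kolmogorov's
  extension theorem they are the laws of the terms of one random refining sequence of cells; the limit
  of that sequence has distribution function \<open>C\<close>, because \<open>C\<close> is Lipschitz.
\<close>

section \<open>Volumes of boxes and grids\<close>

definition mixed_vertex :: "'k set \<Rightarrow> real^'k \<Rightarrow> real^'k \<Rightarrow> real^'k" where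
  "mixed_vertex S x y = (\<chi> i. if i \<in> S then x $ i else y $ i)"

text \<open>Indexing by sets of coordinates instead of vertices counts the vertices of a degenerate
  box with multiplicity, so that they cancel.\<close>

definition signed_volume :: "(real^'k::finite \<Rightarrow> real) \<Rightarrow> real^'k \<Rightarrow> real^'k \<Rightarrow> real" where
  "signed_volume C x y = (\<Sum>S\<in>UNIV. (-1) ^ card S * C (mixed_vertex S x y))"

lemma mixed_vertex_nth [simp]: "mixed_vertex S x y $ i = (if i \<in> S then x $ i else y $ i)"
  by (simp add: mixed_vertex_def)

text \<open>Links the alternating sums of inclusion-exclusion to products over coordinates; it
  serves both for lattice cells and for half-open boxes.\<close>

lemma prod_diff_alternating:
  fixes f g :: "'k::finite \<Rightarrow> 'a::comm_ring_1"
  shows "(\<Prod>i\<in>UNIV. f i - g i) = (\<Sum>S\<in>UNIV. (-1) ^ card S * (\<Prod>i\<in>UNIV. if i \<in> S then g i else f i))"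
  by (simp add: prod_diff_conv_sum prod.If_cases Compl_eq_Diff_UNIV mult.assoc)

text \<open>The sets with and without \<open>i\<close> pair off, and the two members of a pair carry
  opposite signs.\<close>

lemma alternating_sum_eq_0:
  fixes h :: "'k::finite set \<Rightarrow> real"
  assumes "\<And>S. i \<notin> S \<Longrightarrow> h (insert i S) = h S"
  shows "(\<Sum>S\<in>UNIV. (-1) ^ card S * h S) = 0"
proof -
  let ?A = "Pow (UNIV - {i})"
  have U: "(UNIV :: 'k set set) = ?A \<union> insert i ` ?A"
    using Pow_insert[of i "UNIV - {i}"] by (simp add: insert_UNIV)
  have inj: "inj_on (insert i) ?A"
    by (auto simp: inj_on_def)
  have "(\<Sum>S\<in>UNIV. (-1) ^ card S * h S) =
      (\<Sum>S\<in>?A. (-1) ^ card S * h S) + (\<Sum>S\<in>insert i ` ?A. (-1) ^ card S * h S)"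
    by (subst U, rule sum.union_disjoint) auto
  also have "(\<Sum>S\<in>insert i ` ?A. (-1) ^ card S * h S) = (\<Sum>S\<in>?A. - ((-1) ^ card S * h S))"
    unfolding sum.reindex[OF inj]
  proof (rule sum.cong)
    fix S assume "S \<in> ?A"
    then have "i \<notin> S" by auto
    then show "((\<lambda>S. (-1) ^ card S * h S) \<circ> insert i) S = - ((-1) ^ card S * h S)"
      by (simp add: assms)
  qed simp
  finally show ?thesis by (simp add: sum_negf)
qed

text \<open>In a nondegenerate box a vertex determines \<open>S\<close> as the set of coordinates in
  which it agrees with \<open>x\<close>.\<close>

lemma box_volume_eq_signed_volume:
  fixes x y :: "real^'k::finite"
  assumes "\<And>i. x $ i < y $ i"
  shows "box_volume C x y = signed_volume C x y"
proof -
  have ne: "x $ i \<noteq> y $ i" "y $ i \<noteq> x $ i" for i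
    using assms[of i] by auto
  have "bij_betw (\<lambda>S. mixed_vertex S x y) UNIV (box_vertices x y)"
    by (rule bij_betwI[where g = "\<lambda>z. {i. z $ i = x $ i}"])
      (auto simp: box_vertices_def vec_eq_iff ne)
  then have "box_volume C x y = (\<Sum>S\<in>UNIV. (-1) ^ card {i. mixed_vertex S x y $ i = x $ i} * C (mixed_vertex S x y))"
    unfolding box_volume_def by (rule sum.reindex_bij_betw[symmetric])
  then show ?thesis
    by (simp add: signed_volume_def ne)
qed

text \<open>The copula axiom covers nondegenerate boxes only. If edge \<open>i\<close> collapses,
  moving \<open>i\<close> in or out of \<open>S\<close> does not change the vertex, and the volume
  is 0.\<close>

lemma signed_volume_nonneg:
  fixes x y :: "real^'k::finite"
  assumes C: "copula C" and x: "\<And>i. 0 \<le> x $ i" and xy: "\<And>i. x $ i \<le> y $ i" and y: "\<And>i. y $ i \<le> 1"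
  shows "signed_volume C x y \<ge> 0"
proof (cases "\<forall>i. x $ i < y $ i")
  case True
  then have "unit_subbox x y"
    using x y by (auto simp: unit_subbox_def)
  with C True show ?thesis
    by (simp add: copula_def box_volume_eq_signed_volume[symmetric])
next
  case False
  then obtain i where i: "x $ i = y $ i"
    using xy by (metis order_le_less)
  have "signed_volume C x y = 0"
    unfolding signed_volume_def
    by (rule alternating_sum_eq_0[of i], rule arg_cong[of _ _ C]) (auto simp: vec_eq_iff i)
  then show ?thesis by simp
qed

section \<open>Telescoping of mixed differences on the integer lattice\<close>

text \<open>Mixed difference over the unit cell with upper corner \<open>a\<close>. The truncated
  subtraction is harmless, because sums only run over cells with every \<open>a i\<close> at least
  1.\<close>

definition lattice_diff :: "(('k::finite \<Rightarrow> nat) \<Rightarrow> real) \<Rightarrow> ('k \<Rightarrow> nat) \<Rightarrow> real" where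
  "lattice_diff F a = (\<Sum>S\<in>UNIV. (-1) ^ card S * F (\<lambda>i. if i \<in> S then a i - 1 else a i))"

text \<open>
  Writing \<open>F\<close> as a combination of point indicators, which are products of functions of one
  coordinate, reduces the telescoping to dimension one.
\<close>

lemma sum_lattice_diff:
  fixes F :: "('k::finite \<Rightarrow> nat) \<Rightarrow> real"
  assumes F0: "\<And>a i. a i = 0 \<Longrightarrow> F a = 0"
  shows "(\<Sum>a\<in>(\<Pi>\<^sub>E i\<in>UNIV. {1..b i}). lattice_diff F a) = F b"
proof -
  let ?A = "\<Pi>\<^sub>E i\<in>UNIV. {1..b i}" and ?B = "\<Pi>\<^sub>E i\<in>UNIV. {0..b i}"
  define e :: "nat \<Rightarrow> nat \<Rightarrow> real" where "e m n = of_bool (m = n)" for m n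
  have fin: "finite ?A" "finite ?B"
    by (auto intro: finite_PiE)
  have prod_e: "(\<Prod>i\<in>UNIV. e (a i) (c i)) = of_bool (a = c)" for a c :: "'k \<Rightarrow> nat"
    by (auto simp: e_def fun_eq_iff)
  have F: "F a = (\<Sum>c\<in>?B. F c * (\<Prod>i\<in>UNIV. e (a i) (c i)))" if "a \<in> ?B" for a
    using that fin by (simp add: prod_e sum.delta)
  have "(\<Sum>a\<in>?A. lattice_diff F a) =
      (\<Sum>a\<in>?A. \<Sum>S\<in>UNIV. (-1) ^ card S *
        (\<Sum>c\<in>?B. F c * (\<Prod>i\<in>UNIV. if i \<in> S then e (a i - 1) (c i) else e (a i) (c i))))"
    unfolding lattice_diff_def
  proof (intro sum.cong refl arg_cong2[where f = "(*)"])
    fix a S assume "a \<in> ?A"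
    then have "(\<lambda>i. if i \<in> S then a i - 1 else a i) \<in> ?B"
      by (auto simp: PiE_iff intro: diff_le_self order_trans)
    from F[OF this] show "F (\<lambda>i. if i \<in> S then a i - 1 else a i) =
        (\<Sum>c\<in>?B. F c * (\<Prod>i\<in>UNIV. if i \<in> S then e (a i - 1) (c i) else e (a i) (c i)))"
      by (simp add: if_distrib[of "\<lambda>x. e x _"])
  qed
  \<comment> \<open>Summing over \<open>S\<close> first collapses the alternating sum to a product
    of one-coordinate differences.\<close>
  also have "\<dots> = (\<Sum>a\<in>?A. \<Sum>c\<in>?B. F c * (\<Prod>i\<in>UNIV. e (a i) (c i) - e (a i - 1) (c i)))"
    unfolding prod_diff_alternating sum_distrib_left
    by (subst (2) sum.swap) (simp add: mult.left_commute)
  also have "\<dots> = (\<Sum>c\<in>?B. F c * (\<Prod>i\<in>UNIV. \<Sum>n\<in>{1..b i}. e n (c i) - e (n - 1) (c i)))"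
    by (subst sum.swap) (simp add: prod_sum_PiE sum_distrib_left)
  also have "\<dots> = (\<Sum>c\<in>?B. F c * (\<Prod>i\<in>UNIV. e (b i) (c i) - e 0 (c i)))"
    using sum_telescope''[of 0 _ "\<lambda>n. e n _"] by simp
  \<comment> \<open>A lower term \<open>e 0 (c i)\<close> is nonzero only if \<open>c i = 0\<close>,
    and then \<open>F0\<close> makes the coefficient \<open>F c\<close> vanish.\<close>
  also have "\<dots> = (\<Sum>c\<in>?B. F c * (\<Prod>i\<in>UNIV. e (b i) (c i)))"
  proof (intro sum.cong refl)
    fix c show "F c * (\<Prod>i\<in>UNIV. e (b i) (c i) - e 0 (c i)) = F c * (\<Prod>i\<in>UNIV. e (b i) (c i))"
    proof (cases "\<exists>i. c i = 0")
      case True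
      then show ?thesis using F0 by auto
    next
      case False
      then have "e 0 (c i) = 0" for i by (auto simp: e_def)
      then show ?thesis by simp
    qed
  qed
  also have "\<dots> = F b"
    by (rule F[symmetric]) auto
  finally show ?thesis .
qed

section \<open>Grids in the cube and the Lipschitz bound\<close>

definition grid_point :: "('k::finite \<Rightarrow> nat \<Rightarrow> real) \<Rightarrow> ('k \<Rightarrow> nat) \<Rightarrow> real^'k" where
  "grid_point g a = (\<chi> i. g i (a i))"

lemma grid_point_nth [simp]: "grid_point g a $ i = g i (a i)"
  by (simp add: grid_point_def)

lemma in_unit_cube: "x \<in> cbox 0 (1::real^'k) \<longleftrightarrow> (\<forall>i. 0 \<le> x $ i \<and> x $ i \<le> 1)"
  by (simp add: mem_box_cart)

lemma copula_eq_0: "copula C \<Longrightarrow> x \<in> cbox 0 1 \<Longrightarrow> x $ i = 0 \<Longrightarrow> C x = 0"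
  by (auto simp: copula_def)

lemma copula_margin:
  "copula C \<Longrightarrow> 0 \<le> t \<Longrightarrow> t \<le> 1 \<Longrightarrow> C (\<chi> j. if j = i then t else 1) = t"
proof -
  assume "copula C" and t: "0 \<le> t" "t \<le> 1"
  then have "\<And>u. u \<in> cbox 0 1 \<Longrightarrow> \<forall>j. j \<noteq> i \<longrightarrow> u $ j = 1 \<Longrightarrow> C u = u $ i"
    by (simp add: copula_def)
  from this[of "\<chi> j. if j = i then t else 1"] t show ?thesis
    by (simp add: in_unit_cube)
qed

text \<open>Grid lines may repeat: the four-line grid through two given points and the dyadic grid,
  constant after it reaches 1, are both instances.\<close>

locale copula_grid =
  fixes C :: "real^'k::finite \<Rightarrow> real" and g :: "'k \<Rightarrow> nat \<Rightarrow> real"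
  assumes copula: "copula C"
    and g_mono: "\<And>i m n. m \<le> n \<Longrightarrow> g i m \<le> g i n"
    and g_0 [simp]: "\<And>i. g i 0 = 0"
    and g_le_1: "\<And>i n. g i n \<le> 1"
begin

definition weight :: "('k \<Rightarrow> nat) \<Rightarrow> real" where
  "weight = lattice_diff (\<lambda>a. C (grid_point g a))"

lemma g_nonneg: "0 \<le> g i n"
  using g_mono[of 0 n i] by simp

lemma grid_point_in_cube: "grid_point g a \<in> cbox 0 1"
  by (simp add: in_unit_cube g_nonneg g_le_1)

lemma weight_nonneg: "0 \<le> weight a"
proof -
  have "weight a = signed_volume C (grid_point g (\<lambda>i. a i - 1)) (grid_point g a)"
    unfolding weight_def lattice_diff_def signed_volume_def
    by (intro sum.cong refl arg_cong2[where f="(*)"] arg_cong[of _ _ C]) (auto simp: vec_eq_iff)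
  then show ?thesis
    using signed_volume_nonneg[OF copula] by (simp add: g_nonneg g_mono g_le_1)
qed

text \<open>Index 0 is the coordinate 0, where \<open>C\<close> vanishes; this supplies the boundary
  condition of the telescoping.\<close>

lemma sum_weight: "(\<Sum>a\<in>(\<Pi>\<^sub>E i\<in>UNIV. {1..b i}). weight a) = C (grid_point g b)"
  unfolding weight_def
  by (rule sum_lattice_diff) (metis copula_eq_0[OF copula grid_point_in_cube] grid_point_nth g_0)

end

lemma sum_UN_le:
  fixes f :: "'a \<Rightarrow> real"
  assumes "finite I" "\<And>i. i \<in> I \<Longrightarrow> finite (A i)" "\<And>x. 0 \<le> f x"
  shows "sum f (\<Union>i\<in>I. A i) \<le> (\<Sum>i\<in>I. sum f (A i))"
  using assms(1,2)
proof (induction I)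
  case (insert i I)
  then have "sum f (A i \<union> (\<Union>i\<in>I. A i)) \<le> sum f (A i) + sum f (\<Union>i\<in>I. A i)"
    using sum_nonneg[of "A i \<inter> (\<Union>i\<in>I. A i)" f] assms(3) by (subst sum_Un) auto
  with insert show ?case by simp
qed simp

text \<open>The cells below \<open>v\<close> but not below \<open>u\<close> are covered by one slab
  per coordinate, and by the uniform margins the slab in direction \<open>i\<close> has weight
  \<open>v $ i - u $ i\<close>.\<close>

lemma copula_lipschitz:
  fixes C :: "real^'k::finite \<Rightarrow> real"
  assumes C: "copula C" and u: "u \<in> cbox 0 1" and v: "v \<in> cbox 0 1" and uv: "\<And>i. u $ i \<le> v $ i"
  shows "0 \<le> C v - C u" "C v - C u \<le> (\<Sum>i\<in>UNIV. v $ i - u $ i)"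
proof -
  \<comment> \<open>The grid lines in direction \<open>i\<close> are 0, \<open>u $ i\<close>,
    \<open>v $ i\<close> and 1; all indices from 3 on give 1.\<close>
  define g where "g i n = (if n = 0 then 0 else if n = 1 then u $ i else if n = 2 then v $ i else 1)"
    for i and n :: nat
  interpret copula_grid C g
  proof
    fix i and m n :: nat
    have "0 \<le> u $ i" "u $ i \<le> v $ i" "v $ i \<le> 1"
      using u v uv by (auto simp: in_unit_cube)
    then show "m \<le> n \<Longrightarrow> g i m \<le> g i n" "g i 0 = 0" "g i n \<le> 1"
      by (auto simp: g_def)
  qed fact
  define Q :: "('k \<Rightarrow> nat) \<Rightarrow> ('k \<Rightarrow> nat) set" where "Q b = (\<Pi>\<^sub>E i\<in>UNIV. {1..b i})" for b
  have fin: "finite (Q b)" for b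
    by (auto simp: Q_def intro: finite_PiE)
  have sub: "Q b \<subseteq> Q c" if "\<And>i. b i \<le> c i" for b c
    unfolding Q_def using that by (intro PiE_mono) auto
  have Q: "sum weight (Q b) = C (grid_point g b)" for b
    unfolding Q_def by (rule sum_weight)
  have grid: "grid_point g (\<lambda>_. 2) = v" "grid_point g (\<lambda>_. Suc 0) = u"
    by (auto simp: vec_eq_iff g_def)
  have diff: "sum weight (Q c - Q b) = C (grid_point g c) - C (grid_point g b)" if "\<And>i. b i \<le> c i" for b c
    using sum_diff[OF fin sub[OF that], of weight] by (simp add: Q)
  have eq: "C v - C u = sum weight (Q (\<lambda>_. 2) - Q (\<lambda>_. 1))"
    using diff[of "\<lambda>_. 1" "\<lambda>_. 2"] by (simp add: grid)
  show "0 \<le> C v - C u"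
    unfolding eq by (intro sum_nonneg weight_nonneg)
  \<comment> \<open>The slab in direction \<open>i\<close> reaches up to 1 (index 3) in all other
    directions, where the margin condition evaluates \<open>C\<close>.\<close>
  let ?D = "\<lambda>i. Q (\<lambda>j. if j = i then 2 else 3) - Q (\<lambda>j. if j = i then 1 else 3)"
  have D: "sum weight (?D i) = v $ i - u $ i" for i
  proof -
    have "grid_point g (\<lambda>j. if j = i then 2 else 3) = (\<chi> j. if j = i then v $ i else 1)"
      "grid_point g (\<lambda>j. if j = i then 1 else 3) = (\<chi> j. if j = i then u $ i else 1)"
      by (simp_all add: vec_eq_iff g_def)
    then have "sum weight (?D i) = C (\<chi> j. if j = i then v $ i else 1) - C (\<chi> j. if j = i then u $ i else 1)"
      by (subst diff) auto
    also have "\<dots> = v $ i - u $ i"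
      using u v by (simp add: copula_margin[OF C] in_unit_cube)
    finally show ?thesis .
  qed
  \<comment> \<open>A cell outside the lower box has index 2 in some coordinate, which places it in
    the slab of that direction.\<close>
  have "Q (\<lambda>_. 2) - Q (\<lambda>_. 1) \<subseteq> (\<Union>i. ?D i)"
  proof
    fix a assume a: "a \<in> Q (\<lambda>_. 2) - Q (\<lambda>_. 1)"
    then have a12: "1 \<le> a j \<and> a j \<le> 2" for j
      by (simp add: Q_def PiE_iff)
    have "\<not> (\<forall>j. a j \<in> {1..1})"
      using a unfolding Q_def by blast
    then obtain i where "a i \<noteq> 1"
      by auto
    then have i: "\<not> a i \<le> 1"
      using a12[of i] by linarith
    have a13: "1 \<le> a j \<and> a j \<le> 3" for j
      using a12[of j] by linarith
    have "a \<in> ?D i"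
      using i a12 a13 by (auto simp: Q_def PiE_iff)
    then show "a \<in> (\<Union>i. ?D i)" by blast
  qed
  then have "C v - C u \<le> sum weight (\<Union>i. ?D i)"
    unfolding eq by (intro sum_mono2) (auto simp: fin weight_nonneg)
  also have "\<dots> \<le> (\<Sum>i\<in>UNIV. sum weight (?D i))"
    by (intro sum_UN_le) (auto simp: fin weight_nonneg)
  finally show "C v - C u \<le> (\<Sum>i\<in>UNIV. v $ i - u $ i)"
    by (simp add: D)
qed

section \<open>Dyadic laws and their projective limit\<close>

definition round_down :: "nat \<Rightarrow> real^'k \<Rightarrow> real^'k" where
  "round_down n x = (\<chi> i. of_int \<lfloor>2 ^ n * x $ i\<rfloor> / 2 ^ n)"

text \<open>The upper corner of the cell of generation \<open>n\<close> containing \<open>x\<close>.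
  Cells are open below and closed above, in keeping with the orthants \<open>{..t}\<close>.\<close>

definition round_up :: "nat \<Rightarrow> real^'k \<Rightarrow> real^'k" where
  "round_up n x = (\<chi> i. of_int \<lceil>2 ^ n * x $ i\<rceil> / 2 ^ n)"

text \<open>\<open>C\<close> is meaningful only on the cube; composed with this retraction it
  becomes a distribution function on the whole space.\<close>

definition clamp01 :: "real^'k \<Rightarrow> real^'k" where
  "clamp01 x = (\<chi> i. max 0 (min 1 (x $ i)))"

lemma clamp01_nth [simp]: "clamp01 x $ i = max 0 (min 1 (x $ i))"
  by (simp add: clamp01_def)

lemma clamp01_in_cube [simp]: "clamp01 x \<in> cbox 0 1"
  by (simp add: in_unit_cube)

text \<open>A Galois connection: preimages of orthants under \<open>round_up\<close> are orthants.
  It drives the measurability of rounding and the consistency of the dyadic laws.\<close>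

lemma round_up_le_iff: "round_up n x \<le> t \<longleftrightarrow> x \<le> round_down n t"
proof -
  have "of_int \<lceil>2 ^ n * a\<rceil> / 2 ^ n \<le> b \<longleftrightarrow> a \<le> of_int \<lfloor>2 ^ n * b\<rfloor> / 2 ^ n" for a b :: real
    by (simp add: divide_le_eq le_divide_eq mult.commute flip: le_floor_iff ceiling_le_iff)
  then show ?thesis
    by (simp add: less_eq_vec_def round_up_def round_down_def)
qed

text \<open>A dyadic point of generation \<open>j\<close> already lies on the finer grid of
  generation \<open>n\<close>.\<close>

lemma round_down_round_down:
  assumes "j \<le> n"
  shows "round_down n (round_down j x) = round_down j x"
proof -
  have pow: "(2::real) ^ n = 2 ^ (n - j) * 2 ^ j"
    using assms by (simp flip: power_add)
  then have "2 ^ n * (of_int \<lfloor>a\<rfloor> / 2 ^ j) = (of_int (2 ^ (n - j) * \<lfloor>a\<rfloor>) :: real)" for a :: real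
    by simp
  then have "of_int \<lfloor>2 ^ n * (of_int \<lfloor>a\<rfloor> / 2 ^ j) :: real\<rfloor> / 2 ^ n = (of_int \<lfloor>a\<rfloor> / 2 ^ j :: real)" for a :: real
    by (simp only: floor_of_int) (simp add: pow)
  then show ?thesis
    unfolding round_down_def vec_eq_iff vec_lambda_beta by blast
qed

text \<open>By the Galois connection both sides have the same upper bounds.\<close>

lemma round_up_round_up:
  assumes "j \<le> n"
  shows "round_up j (round_up n x) = round_up j x"
proof -
  have "round_up j (round_up n x) \<le> t \<longleftrightarrow> round_up j x \<le> t" for t
    by (simp add: round_up_le_iff round_down_round_down assms)
  then show ?thesis
    by (metis order_refl order_antisym)
qed

lemma round_up_bounds: "x $ i \<le> round_up n x $ i" "round_up n x $ i \<le> x $ i + 1 / 2 ^ n"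
proof -
  have "2 ^ n * x $ i \<le> of_int \<lceil>2 ^ n * x $ i\<rceil>" "of_int \<lceil>2 ^ n * x $ i\<rceil> \<le> 2 ^ n * x $ i + 1"
    by linarith+
  then show "x $ i \<le> round_up n x $ i" "round_up n x $ i \<le> x $ i + 1 / 2 ^ n"
    by (auto simp: round_up_def field_simps)
qed

lemma round_down_bounds: "round_down n x $ i \<le> x $ i" "x $ i \<le> round_down n x $ i + 1 / 2 ^ n"
proof -
  have "of_int \<lfloor>2 ^ n * x $ i\<rfloor> \<le> 2 ^ n * x $ i" "2 ^ n * x $ i \<le> of_int \<lfloor>2 ^ n * x $ i\<rfloor> + 1"
    by linarith+
  then show "round_down n x $ i \<le> x $ i" "x $ i \<le> round_down n x $ i + 1 / 2 ^ n"
    by (auto simp: round_down_def field_simps)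
qed

lemma atMost_borel [measurable]: "{..t :: real^'k::finite} \<in> sets borel"
  by (intro borel_closed) (rule closed_eucl_atMost)

lemma measurable_round_up [measurable]: "round_up n \<in> borel \<rightarrow>\<^sub>M (borel :: (real^'k::finite) measure)"
proof (subst (2) borel_eq_atMost, rule measurable_measure_of)
  fix A :: "(real^'k) set" assume "A \<in> range atMost"
  then obtain t where "A = {..t}" by auto
  then have "round_up n -` A = {..round_down n t}"
    by (auto simp: round_up_le_iff)
  then show "round_up n -` A \<inter> space borel \<in> sets borel"
    by simp
qed auto

text \<open>Orthants are stable under intersection, generate the Borel sets and exhaust the
  space.\<close>

lemma borel_measure_eqI_cdf:
  fixes M N :: "(real^'k::finite) measure"
  assumes M: "sets M = sets borel" and N: "sets N = sets borel"
    and fin: "finite_measure M" and eq: "\<And>t. emeasure M {..t} = emeasure N {..t}"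
  shows "M = N"
proof (rule measure_eqI_generator_eq)
  let ?E = "range atMost :: (real^'k) set set"
  show "Int_stable ?E"
  proof (rule Int_stableI)
    fix a b assume "a \<in> ?E" "b \<in> ?E"
    then obtain s t where "a = {..s}" "b = {..t}" by auto
    then have "a \<inter> b = {..(\<chi> i. min (s $ i) (t $ i))}"
      by (auto simp: less_eq_vec_def)
    then show "a \<inter> b \<in> ?E" by blast
  qed
  show "sets M = sigma_sets UNIV ?E" "sets N = sigma_sets UNIV ?E"
    by (simp_all add: M N borel_eq_atMost)
  show "(\<Union>n. {..(\<chi> i. real n) :: real^'k}) = UNIV"
  proof (intro set_eqI iffI UNIV_I)
    fix x :: "real^'k"
    obtain n where "Max (range (\<lambda>i. x $ i)) \<le> real n"
      using real_arch_simple by blast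
    then have "x \<le> (\<chi> i. real n)"
      by (auto simp: less_eq_vec_def)
    then show "x \<in> (\<Union>n. {..(\<chi> i. real n)})" by auto
  qed
  show "emeasure M {..(\<chi> i. real n)} \<noteq> \<infinity>" for n
    using finite_measure.emeasure_finite[OF fin] by simp
qed (auto simp: eq)

lemma copula_1: "copula C \<Longrightarrow> C 1 = 1"
  using copula_margin[of C 1 undefined] by (simp add: one_vec_def cong: if_cong)

text \<open>Each cell of generation \<open>n\<close> puts its weight on its upper corner. The
  corners below \<open>t\<close> are exactly those below \<open>round_down n t\<close>, so their
  weights telescope.\<close>

lemma dyadic_law_exists:
  fixes C :: "real^'k::finite \<Rightarrow> real"
  assumes C: "copula C"
  shows "\<exists>N. prob_space N \<and> sets N = sets borel \<and> (\<forall>t. emeasure N {..t} = ennreal (C (clamp01 (round_down n t))))"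
proof -
  \<comment> \<open>The cap at 1 keeps the grid lines with index above \<open>2 ^ n\<close> in the
    cube.\<close>
  define g where "g i a = min 1 (real a / 2 ^ n)" for i :: 'k and a
  interpret copula_grid C g
  proof
    show "g i l \<le> g i m" if "l \<le> m" for i l m
      using that unfolding g_def by (intro min.mono divide_right_mono) auto
  qed (use C in \<open>auto simp: g_def\<close>)
  define A where "A = (\<Pi>\<^sub>E i\<in>(UNIV::'k set). {1..2 ^ n :: nat})"
  define N where "N = distr (point_measure A (\<lambda>a. ennreal (weight a))) borel (grid_point g)"
  have A: "finite A"
    by (auto simp: A_def intro: finite_PiE)
  have N: "emeasure N {..t} = ennreal (C (clamp01 (round_down n t)))" for t
  proof -
    \<comment> \<open>Index of the last line of the dyadic grid not above \<open>t $ i\<close>. A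
      negative floor becomes 0 under \<open>nat\<close>, which empties
      \<open>{1..b i}\<close>.\<close>
    define b where "b i = nat (min (2 ^ n) \<lfloor>2 ^ n * t $ i\<rfloor>)" for i
    have "grid_point g -` {..t} \<inter> A = (\<Pi>\<^sub>E i\<in>UNIV. {1..b i})"
    proof -
      have "1 \<le> m \<and> m \<le> 2 ^ n \<and> g i m \<le> t $ i \<longleftrightarrow> 1 \<le> m \<and> m \<le> b i" for i m
      proof (cases "1 \<le> m \<and> m \<le> 2 ^ n")
        case True
        then have m: "real m \<le> 2 ^ n"
          by (metis of_nat_le_iff of_nat_numeral of_nat_power)
        then have "g i m = real m / 2 ^ n"
          by (simp add: g_def)
        then have "g i m \<le> t $ i \<longleftrightarrow> real m \<le> 2 ^ n * t $ i"
          by (simp add: divide_le_eq mult.commute)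
        also have "\<dots> \<longleftrightarrow> int m \<le> \<lfloor>2 ^ n * t $ i\<rfloor>"
          by (simp add: le_floor_iff)
        also have "\<dots> \<longleftrightarrow> m \<le> b i"
        proof -
          have "int m \<le> 2 ^ n"
            using True by (metis of_nat_le_iff of_nat_numeral of_nat_power)
          moreover have "m \<le> b i \<longleftrightarrow> int m \<le> min (2 ^ n) \<lfloor>2 ^ n * t $ i\<rfloor>"
            using True unfolding b_def by linarith
          ultimately show ?thesis by simp
        qed
        finally show ?thesis using True by simp
      next
        case False
        moreover have "b i \<le> 2 ^ n"
          using nat_mono[of "min (2 ^ n) \<lfloor>2 ^ n * t $ i\<rfloor>" "2 ^ n"] by (simp add: b_def nat_power_eq)
        ultimately show ?thesis
          by auto
      qed
      then show ?thesis
        unfolding A_def by (simp add: set_eq_iff PiE_iff less_eq_vec_def) metis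
    qed
    moreover have "grid_point g b = clamp01 (round_down n t)"
    proof -
      have "g i (b i) = max 0 (min 1 (of_int \<lfloor>2 ^ n * t $ i\<rfloor> / 2 ^ n))" for i
        by (auto simp: g_def b_def min_def max_def field_simps)
      then show ?thesis
        by (simp add: vec_eq_iff round_down_def)
    qed
    ultimately have "emeasure N {..t} = (\<Sum>a\<in>(\<Pi>\<^sub>E i\<in>UNIV. {1..b i}). ennreal (weight a))"
      using A unfolding N_def
      by (subst emeasure_distr) (auto simp: space_point_measure emeasure_point_measure_finite_if)
    also have "\<dots> = ennreal (C (clamp01 (round_down n t)))"
      using sum_weight[of b] \<open>grid_point g b = _\<close> by (simp add: sum_ennreal weight_nonneg)
    finally show ?thesis .
  qed
  have "prob_space N"
    unfolding N_def
  proof (intro prob_space.prob_space_distr prob_spaceI)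
    have "emeasure (point_measure A (\<lambda>a. ennreal (weight a))) A = ennreal (sum weight A)"
      using A by (simp add: emeasure_point_measure_finite_if sum_ennreal weight_nonneg)
    also have "sum weight A = C (grid_point g (\<lambda>_. 2 ^ n))"
      unfolding A_def by (rule sum_weight)
    also have "grid_point g (\<lambda>_. 2 ^ n) = 1"
      by (simp add: vec_eq_iff g_def)
    finally show "emeasure (point_measure A (\<lambda>a. ennreal (weight a)))
        (space (point_measure A (\<lambda>a. ennreal (weight a)))) = 1"
      by (simp add: space_point_measure copula_1[OF C])
  qed simp
  then show ?thesis
    using N by (intro exI[of _ N]) (auto simp: N_def)
qed

section \<open>The projective family of dyadic laws\<close>

locale fixed_copula =
  fixes C :: "real^'k::finite \<Rightarrow> real"
  assumes copula: "copula C"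
begin

definition dyadic_law :: "nat \<Rightarrow> (real^'k) measure" where
  "dyadic_law n = (SOME N. prob_space N \<and> sets N = sets borel \<and>
     (\<forall>t. emeasure N {..t} = ennreal (C (clamp01 (round_down n t)))))"

lemma prob_space_dyadic_law: "prob_space (dyadic_law n)"
  and sets_dyadic_law [measurable_cong, simp]: "sets (dyadic_law n) = sets borel"
  and emeasure_dyadic_law: "emeasure (dyadic_law n) {..t} = ennreal (C (clamp01 (round_down n t)))"
  using someI_ex[OF dyadic_law_exists[OF copula, of n]] unfolding dyadic_law_def by blast+

lemma space_dyadic_law [simp]: "space (dyadic_law n) = UNIV"
  using sets_eq_imp_space_eq[OF sets_dyadic_law] by simp

text \<open>The preimage of \<open>{..t}\<close> is the orthant at \<open>round_down j t\<close>, a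
  point that \<open>round_down n\<close> fixes; so both laws have the same distribution
  function.\<close>

lemma distr_dyadic_law:
  assumes "j \<le> n"
  shows "distr (dyadic_law n) borel (round_up j) = dyadic_law j"
proof (rule borel_measure_eqI_cdf)
  interpret prob_space "dyadic_law n" by (rule prob_space_dyadic_law)
  show "finite_measure (distr (dyadic_law n) borel (round_up j))"
    by (rule finite_measure_distr) simp
  fix t :: "real^'k"
  have "round_up j -` {..t} = {..round_down j t}"
    by (auto simp: round_up_le_iff)
  then show "emeasure (distr (dyadic_law n) borel (round_up j)) {..t} = emeasure (dyadic_law j) {..t}"
    by (simp add: emeasure_distr emeasure_dyadic_law round_down_round_down assms)
qed auto

lemma measurable_round_up_family [measurable]:
  "(\<lambda>x. \<lambda>j\<in>J. round_up j x) \<in> dyadic_law n \<rightarrow>\<^sub>M (\<Pi>\<^sub>M j\<in>J. borel)"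
  by (subst measurable_cong_sets[OF sets_dyadic_law refl]) (intro measurable_restrict measurable_round_up)

text \<open>One point is drawn from the law of the finest generation in \<open>J\<close> and rounded
  to every generation in \<open>J\<close>. Inserting 0 keeps \<open>Max\<close> meaningful for empty
  \<open>J\<close>.\<close>

definition joint_law :: "nat set \<Rightarrow> (nat \<Rightarrow> real^'k) measure" where
  "joint_law J = distr (dyadic_law (Max (insert 0 J))) (\<Pi>\<^sub>M j\<in>J. borel) (\<lambda>x. \<lambda>j\<in>J. round_up j x)"

text \<open>By consistency, any generation at least as fine as all of \<open>J\<close> can replace
  the maximum.\<close>

lemma joint_law_eq:
  assumes "finite J" "\<And>j. j \<in> J \<Longrightarrow> j \<le> n"
  shows "joint_law J = distr (dyadic_law n) (\<Pi>\<^sub>M j\<in>J. borel) (\<lambda>x. \<lambda>j\<in>J. round_up j x)"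
proof -
  let ?m = "Max (insert 0 J)"
  have "?m \<le> n"
    using assms by auto
  have "(\<lambda>j\<in>J. round_up j (round_up ?m x)) = (\<lambda>j\<in>J. round_up j x)" for x :: "real^'k"
    using assms by (auto intro!: restrict_ext round_up_round_up)
  then show ?thesis
    unfolding joint_law_def distr_dyadic_law[OF \<open>?m \<le> n\<close>, symmetric]
    by (subst distr_distr) (auto simp: comp_def)
qed

text \<open>Kolmogorov's consistency condition: once both laws are taken from the generation
  \<open>?n\<close>, it amounts to restricting a single family of roundings.\<close>

sublocale polish_projective UNIV joint_law
proof (intro polish_projective.intro projective_family.intro)
  fix J H :: "nat set" assume *: "J \<subseteq> H" "finite H"
  let ?n = "Max (insert 0 H)"
  have n: "j \<le> ?n" if "j \<in> H" for j
    using * that by auto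
  from * have "H \<inter> J = J" by auto
  have "joint_law H = distr (dyadic_law ?n) (\<Pi>\<^sub>M j\<in>H. borel) (\<lambda>x. \<lambda>j\<in>H. round_up j x)"
    by (rule joint_law_eq) (use * n in auto)
  moreover have "joint_law J = distr (dyadic_law ?n) (\<Pi>\<^sub>M j\<in>J. borel) (\<lambda>x. \<lambda>j\<in>J. round_up j x)"
    by (rule joint_law_eq) (use * n finite_subset in auto)
  ultimately show "joint_law J = distr (joint_law H) (\<Pi>\<^sub>M j\<in>J. borel) (\<lambda>f. restrict f J)"
    using * \<open>H \<inter> J = J\<close> by (simp add: distr_distr comp_def measurable_restrict_subset)
next
  fix J :: "nat set"
  show "prob_space (joint_law J)"
    unfolding joint_law_def by (intro prob_space.prob_space_distr prob_space_dyadic_law measurable_round_up_family)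
qed

lemma distr_lim:
  assumes "finite J"
  shows "distr lim (\<Pi>\<^sub>M j\<in>J. borel) (\<lambda>\<omega>. restrict \<omega> J) = joint_law J"
proof (rule measure_eqI)
  have meas: "(\<lambda>\<omega>. restrict \<omega> J) \<in> lim \<rightarrow>\<^sub>M (\<Pi>\<^sub>M j\<in>J. borel)"
    by (subst measurable_cong_sets[OF sets_lim refl]) (rule measurable_restrict_subset, simp)
  fix X assume "X \<in> sets (distr lim (\<Pi>\<^sub>M j\<in>J. borel) (\<lambda>\<omega>. restrict \<omega> J))"
  then have X: "X \<in> sets (\<Pi>\<^sub>M j\<in>J. borel)" by simp
  show "emeasure (distr lim (\<Pi>\<^sub>M j\<in>J. borel) (\<lambda>\<omega>. restrict \<omega> J)) X = emeasure (joint_law J) X"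
    using emeasure_lim_emb[OF _ assms X] by (simp add: emeasure_distr[OF meas X] prod_emb_def space_PiM)
qed (simp add: sets_P assms)

lemma measurable_lim_component [measurable]: "(\<lambda>\<omega>. \<omega> j) \<in> lim \<rightarrow>\<^sub>M borel"
  by (subst measurable_cong_sets[OF sets_lim refl]) simp

lemma distr_lim_component: "distr lim borel (\<lambda>\<omega>. \<omega> j) = dyadic_law j"
proof -
  have meas: "(\<lambda>\<omega>. restrict \<omega> {j}) \<in> lim \<rightarrow>\<^sub>M (\<Pi>\<^sub>M j\<in>{j}. borel)"
    by (subst measurable_cong_sets[OF sets_lim refl]) (rule measurable_restrict_subset, simp)
  have "distr lim borel (\<lambda>\<omega>. \<omega> j) = distr (joint_law {j}) borel (\<lambda>f. f j)"
    unfolding distr_lim[of "{j}", simplified, symmetric]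
    by (subst distr_distr[OF _ meas]) (auto simp: comp_def)
  also have "\<dots> = dyadic_law j"
  proof -
    have "distr (distr (dyadic_law j) (\<Pi>\<^sub>M j\<in>{j}. borel) (\<lambda>x. \<lambda>j\<in>{j}. round_up j x)) borel (\<lambda>f. f j) =
        distr (dyadic_law j) borel (round_up j)"
      by (subst distr_distr) (auto simp: comp_def)
    then show ?thesis
      by (subst joint_law_eq[of _ j]) (auto simp: distr_dyadic_law)
  qed
  finally show ?thesis .
qed

text \<open>For each of the countably many pairs only two coordinates matter, so the claim can be
  checked under \<open>joint_law {j, m}\<close>, where both are roundings of one point.\<close>

lemma AE_lim_round_up: "AE \<omega> in lim. \<forall>m. \<forall>j\<le>m. \<omega> j = round_up j (\<omega> m)"
proof -
  have "AE \<omega> in lim. \<omega> j = round_up j (\<omega> m)" if "j \<le> m" for j m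
  proof -
    have meas: "(\<lambda>\<omega>. restrict \<omega> {j, m}) \<in> lim \<rightarrow>\<^sub>M (\<Pi>\<^sub>M j\<in>{j, m}. borel)"
      by (subst measurable_cong_sets[OF sets_lim refl]) (rule measurable_restrict_subset, simp)
    have [measurable]: "(\<lambda>f. f j) \<in> (\<Pi>\<^sub>M j\<in>{j, m}. borel :: (real^'k) measure) \<rightarrow>\<^sub>M borel"
      "(\<lambda>f. f m) \<in> (\<Pi>\<^sub>M j\<in>{j, m}. borel :: (real^'k) measure) \<rightarrow>\<^sub>M borel"
      by (auto intro: measurable_component_singleton)
    have "AE f in joint_law {j, m}. f j = round_up j (f m)"
    proof -
      show ?thesis
        using that by (subst joint_law_eq[of _ m]) (auto simp: AE_distr_iff round_up_round_up)
    qed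
    then show ?thesis
      unfolding distr_lim[of "{j, m}", simplified, symmetric]
      by (subst (asm) AE_distr_iff[OF meas]) auto
  qed
  then show ?thesis
    by (simp add: AE_all_countable)
qed

end

section \<open>The limit law\<close>

text \<open>Each coordinate decreases, and all later terms stay within one cell side
  \<open>1 / 2 ^ j\<close> of term \<open>j\<close>.\<close>

lemma refining_sequence_converges:
  fixes \<omega> :: "nat \<Rightarrow> real^'k::finite"
  assumes \<omega>: "\<And>m j. j \<le> m \<Longrightarrow> \<omega> j = round_up j (\<omega> m)"
  obtains x where "\<omega> \<longlonglongrightarrow> x" "\<And>j i. x $ i \<le> \<omega> j $ i" "\<And>j i. \<omega> j $ i \<le> x $ i + 1 / 2 ^ j"
proof -
  have step: "\<omega> m $ i \<le> \<omega> j $ i" "\<omega> j $ i \<le> \<omega> m $ i + 1 / 2 ^ j" if "j \<le> m" for i j m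
    using round_up_bounds[where x="\<omega> m" and i=i and n=j] \<omega>[OF that] by auto
  have "\<exists>L. (\<lambda>j. \<omega> j $ i) \<longlonglongrightarrow> L \<and> (\<forall>j. L \<le> \<omega> j $ i)" for i
  proof -
    have "decseq (\<lambda>j. \<omega> j $ i)"
      using step by (auto simp: decseq_def)
    \<comment> \<open>Cells of generation 0 have side 1, which bounds the whole sequence from
      below.\<close>
    moreover have "\<forall>j. \<omega> 0 $ i - 1 \<le> \<omega> j $ i"
      using step(2)[of 0] by (auto simp: algebra_simps)
    ultimately show ?thesis
      by (metis decseq_convergent)
  qed
  then obtain L where L: "\<And>i. (\<lambda>j. \<omega> j $ i) \<longlonglongrightarrow> L i" "\<And>i j. L i \<le> \<omega> j $ i"
    by metis
  have "\<omega> j $ i \<le> L i + 1 / 2 ^ j" for i j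
    using L(1)[of i] step(2)[of j _ i]
    by (intro LIMSEQ_le_const[OF tendsto_add[OF L(1) tendsto_const]]) auto
  with L show ?thesis
    by (intro that[of "\<chi> i. L i"]) (auto intro: vec_tendstoI)
qed

text \<open>
  Extending the copula measure from the cube to all of the space keeps the \<open>\<sigma>\<close>-algebra standard.
\<close>

definition copula_law :: "(real^'k::finite \<Rightarrow> real) \<Rightarrow> (real^'k) measure \<Rightarrow> bool" where
  "copula_law C M \<longleftrightarrow> prob_space M \<and> sets M = sets borel \<and> (AE x in M. x \<in> cbox 0 1) \<and>
     (\<forall>u\<in>cbox 0 1. measure M {..u} = C u)"

context fixed_copula
begin

text \<open>Plain \<open>lim\<close> is the projective limit measure on sequences, whereas
  \<open>Topological_Spaces.lim\<close> takes the limit of a single sequence.\<close>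

definition limit_law :: "(real^'k) measure" where
  "limit_law = distr lim borel (\<lambda>\<omega>. Topological_Spaces.lim \<omega>)"

lemma measurable_limit [measurable]: "(\<lambda>\<omega>. Topological_Spaces.lim \<omega>) \<in> lim \<rightarrow>\<^sub>M (borel :: (real^'k) measure)"
  using borel_measurable_lim_metric[of "\<lambda>j \<omega>. \<omega> j" lim] measurable_lim_component by simp

lemma prob_space_limit_law: "prob_space limit_law"
  unfolding limit_law_def by (rule P.prob_space_distr) simp

lemma AE_lim_bounds:
  "AE \<omega> in lim. \<forall>j i. Topological_Spaces.lim \<omega> $ i \<le> \<omega> j $ i \<and> \<omega> j $ i \<le> Topological_Spaces.lim \<omega> $ i + 1 / 2 ^ j"
  using AE_lim_round_up
proof eventually_elim
  fix \<omega> :: "nat \<Rightarrow> real^'k" assume "\<forall>m. \<forall>j\<le>m. \<omega> j = round_up j (\<omega> m)"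
  then obtain x where x: "\<omega> \<longlonglongrightarrow> x" "\<And>j i. x $ i \<le> \<omega> j $ i" "\<And>j i. \<omega> j $ i \<le> x $ i + 1 / 2 ^ j"
    using refining_sequence_converges[of \<omega>] by blast
  then show "\<forall>j i. Topological_Spaces.lim \<omega> $ i \<le> \<omega> j $ i \<and> \<omega> j $ i \<le> Topological_Spaces.lim \<omega> $ i + 1 / 2 ^ j"
    using limI[OF x(1)] by simp
qed

lemma prob_lim_component: "measure lim {\<omega> \<in> space lim. \<omega> j \<le> t} = C (clamp01 (round_down j t))"
proof -
  have "measure lim {\<omega> \<in> space lim. \<omega> j \<le> t} = measure (distr lim borel (\<lambda>\<omega>. \<omega> j)) {..t}"
    by (subst measure_distr) (auto intro!: arg_cong[of _ _ "measure lim"])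
  also have "\<dots> = C (clamp01 (round_down j t))"
  proof -
    have "0 \<le> C (clamp01 (round_down j t))"
      using copula clamp01_in_cube[of "round_down j t"] by (auto simp: copula_def simp del: clamp01_in_cube)
    then show ?thesis
      unfolding distr_lim_component by (simp add: measure_def emeasure_dyadic_law)
  qed
  finally show ?thesis .
qed

text \<open>Almost surely, if term \<open>j\<close> is below \<open>u\<close> then so is the limit,
  and if the limit is below \<open>u\<close> then term \<open>j\<close> is below \<open>u\<close>
  shifted by \<open>1 / 2 ^ j\<close>. By the Lipschitz bound both outer probabilities tend to
  \<open>C u\<close>.\<close>

lemma limit_law_atMost:
  assumes u: "u \<in> cbox 0 1"
  shows "measure limit_law {..u} = C u"
proof -
  let ?X = "Topological_Spaces.lim :: (nat \<Rightarrow> real^'k) \<Rightarrow> real^'k"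
  have eq: "measure limit_law {..u} = measure lim {\<omega> \<in> space lim. ?X \<omega> \<le> u}"
    unfolding limit_law_def by (subst measure_distr) (auto intro!: arg_cong[of _ _ "measure lim"])
  have [measurable]: "{\<omega> \<in> space lim. \<omega> j \<le> t} \<in> sets lim" "{\<omega> \<in> space lim. ?X \<omega> \<le> t} \<in> sets lim" for j and t :: "real^'k"
    using measurable_sets[OF measurable_lim_component, of "{..t}" j] measurable_sets[OF measurable_limit, of "{..t}"]
    by (auto simp: vimage_def Int_def conj_commute)
  \<comment> \<open>The number of coordinates, which is the number of summands in the Lipschitz
    bound.\<close>
  define c where "c = (\<Sum>i\<in>(UNIV::'k set). 1 :: real)"
  have "\<bar>measure limit_law {..u} - C u\<bar> \<le> c * (1 / 2) ^ j" for j
  proof -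
    let ?u' = "\<chi> i. u $ i + 1 / 2 ^ j"
    let ?v = "clamp01 (round_down j u)" and ?w = "clamp01 (round_down j ?u')"
    have "C ?v \<le> measure limit_law {..u}"
      unfolding eq prob_lim_component[symmetric]
      by (rule P.finite_measure_mono_AE)
        (use AE_lim_bounds in \<open>eventually_elim, auto simp: less_eq_vec_def intro: order_trans\<close>, measurable)
    moreover have "measure limit_law {..u} \<le> C ?w"
      unfolding eq prob_lim_component[symmetric]
    proof (rule P.finite_measure_mono_AE)
      show "AE \<omega> in lim. \<omega> \<in> {\<omega> \<in> space lim. ?X \<omega> \<le> u} \<longrightarrow> \<omega> \<in> {\<omega> \<in> space lim. \<omega> j \<le> ?u'}"
        using AE_lim_bounds
      proof eventually_elim
        fix \<omega> assume *: "\<forall>j i. ?X \<omega> $ i \<le> \<omega> j $ i \<and> \<omega> j $ i \<le> ?X \<omega> $ i + 1 / 2 ^ j"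
        have "\<omega> j $ i \<le> u $ i + 1 / 2 ^ j" if "?X \<omega> \<le> u" for i
          using *[rule_format, of i j] that by (simp add: less_eq_vec_def) (metis add_right_mono order_trans)
        then show "\<omega> \<in> {\<omega> \<in> space lim. ?X \<omega> \<le> u} \<longrightarrow> \<omega> \<in> {\<omega> \<in> space lim. \<omega> j \<le> ?u'}"
          by (auto simp: less_eq_vec_def)
      qed
    qed measurable
    moreover have "C u - C ?v \<le> c * (1 / 2) ^ j"
    proof -
      have *: "?v $ i \<le> u $ i \<and> u $ i \<le> ?v $ i + 1 / 2 ^ j" for i
      proof -
        have "0 \<le> u $ i" "u $ i \<le> 1" "0 \<le> 1 / (2::real) ^ j"
          using u by (auto simp: in_unit_cube)
        then show ?thesis
          using round_down_bounds[where x=u and n=j and i=i] unfolding clamp01_nth by linarith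
      qed
      then have "C u - C ?v \<le> (\<Sum>i\<in>UNIV. u $ i - ?v $ i)"
        by (intro copula_lipschitz[OF copula]) (use u in auto)
      also have "\<dots> \<le> (\<Sum>i\<in>(UNIV::'k set). 1 / 2 ^ j)"
        using * by (intro sum_mono) (simp add: algebra_simps)
      finally show ?thesis by (simp add: c_def power_divide)
    qed
    moreover have "C ?w - C u \<le> c * (1 / 2) ^ j"
    proof -
      \<comment> \<open>Rounding down loses at most the added \<open>1 / 2 ^ j\<close>, so
        \<open>?w\<close> stays above \<open>u\<close>.\<close>
      have *: "u $ i \<le> ?w $ i \<and> ?w $ i \<le> u $ i + 1 / 2 ^ j" for i
      proof -
        have "round_down j ?u' $ i \<le> u $ i + 1 / 2 ^ j" "u $ i \<le> round_down j ?u' $ i"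
          using round_down_bounds[where x="?u'" and n=j and i=i] by auto
        moreover have "0 \<le> u $ i" "u $ i \<le> 1" "0 \<le> 1 / (2::real) ^ j"
          using u by (auto simp: in_unit_cube)
        ultimately show ?thesis
          unfolding clamp01_nth by linarith
      qed
      then have "C ?w - C u \<le> (\<Sum>i\<in>UNIV. ?w $ i - u $ i)"
        by (intro copula_lipschitz[OF copula]) (use u in auto)
      also have "\<dots> \<le> (\<Sum>i\<in>(UNIV::'k set). 1 / 2 ^ j)"
        using * by (intro sum_mono) (simp add: algebra_simps)
      finally show ?thesis by (simp add: c_def power_divide)
    qed
    ultimately show ?thesis by linarith
  qed
  moreover have "(\<lambda>j. c * (1 / 2) ^ j) \<longlonglongrightarrow> c * 0"
    by (intro tendsto_intros LIMSEQ_realpow_zero) auto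
  ultimately have "\<bar>measure limit_law {..u} - C u\<bar> \<le> c * 0"
    by (intro LIMSEQ_le_const) auto
  then show ?thesis by simp
qed

text \<open>The orthant at the all-ones vector has mass \<open>C 1 = 1\<close>, and lowering one of
  its coordinates to 0 gives mass 0; so the law sits on the cube.\<close>

lemma copula_law_limit_law: "copula_law C limit_law"
proof -
  interpret M: prob_space limit_law by (rule prob_space_limit_law)
  have [simp]: "sets limit_law = sets borel"
    by (simp add: limit_law_def)
  then have [simp]: "space limit_law = UNIV"
    by (metis sets_eq_imp_space_eq space_borel)
  have "AE x in limit_law. x \<le> 1"
    using limit_law_atMost[of 1] copula_1[OF copula] M.AE_prob_1[of "{..1}"] by (simp add: in_unit_cube)
  moreover have "AE x in limit_law. \<not> x \<le> (\<chi> j. if j = i then 0 else 1)" for i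
  proof -
    let ?u = "\<chi> j. if j = i then 0 else (1::real)"
    have "?u \<in> cbox 0 1" by (simp add: in_unit_cube)
    then have "measure limit_law {..?u} = 0"
      using limit_law_atMost copula_eq_0[OF copula, of ?u i] by simp
    then show ?thesis
      by (intro AE_I'[of "{..?u}"]) (auto simp: null_sets_def M.emeasure_eq_measure)
  qed
  then have "AE x in limit_law. \<forall>i. \<not> x \<le> (\<chi> j. if j = i then 0 else 1)"
    by (simp add: AE_all_countable)
  ultimately have "AE x in limit_law. x \<in> cbox 0 1"
  proof eventually_elim
    fix x :: "real^'k" assume "x \<le> 1" and *: "\<forall>i. \<not> x \<le> (\<chi> j. if j = i then 0 else 1)"
    then have "\<not> x $ i \<le> 0" for i
      using *[rule_format, of i] by (auto simp: less_eq_vec_def split: if_splits)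
    then have "0 \<le> x $ i" for i
      by (meson linear)
    with \<open>x \<le> 1\<close> show "x \<in> cbox 0 1"
      by (auto simp: in_unit_cube less_eq_vec_def)
  qed
  then show ?thesis
    by (simp add: copula_law_def M.prob_space_axioms limit_law_atMost)
qed

end

section \<open>Existence and uniqueness of the copula measure\<close>

lemma prod_of_bool: "(\<Prod>i\<in>UNIV. of_bool (P i)) = (of_bool (\<forall>i::'k::finite. P i) :: real)"
proof (cases "\<forall>i. P i")
  case False
  then obtain i where "\<not> P i" by blast
  then have "(\<Prod>i\<in>UNIV. of_bool (P i)) = (0 :: real)"
    by (intro prod_zero bexI[of _ i]) auto
  with False show ?thesis by simp
qed simp

lemma prod_indicator_diff:
  fixes x y w :: "real^'k::finite"
  assumes "\<And>i. x $ i \<le> y $ i"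
  shows "(\<Prod>i\<in>UNIV. of_bool (w $ i \<le> y $ i) - of_bool (w $ i \<le> x $ i)) =
    (indicator {w. \<forall>i. x $ i < w $ i \<and> w $ i \<le> y $ i} w :: real)"
proof -
  have *: "of_bool (w $ i \<le> y $ i) - of_bool (w $ i \<le> x $ i) =
      (of_bool (x $ i < w $ i \<and> w $ i \<le> y $ i) :: real)" for i
    using assms[of i] by (auto simp: of_bool_def)
  show ?thesis
    unfolding * prod_of_bool by (simp add: indicator_def)
qed

text \<open>The indicator of the box is a product of differences of half-line indicators; expanding
  the product and integrating gives the alternating sum.\<close>

lemma measure_half_open_box:
  fixes x y :: "real^'k::finite"
  assumes "finite_measure M" and M: "sets M = sets borel" and xy: "\<And>i. x $ i \<le> y $ i"
  shows "measure M {w. \<forall>i. x $ i < w $ i \<and> w $ i \<le> y $ i} = signed_volume (\<lambda>u. measure M {..u}) x y"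
proof -
  interpret finite_measure M by fact
  let ?B = "{w. \<forall>i. x $ i < w $ i \<and> w $ i \<le> y $ i}"
  have space: "space M = UNIV"
    using sets_eq_imp_space_eq[OF M] by simp
  have [simp]: "{..u} \<in> sets M" for u
    by (simp add: M)
  have *: "(\<Sum>S\<in>UNIV. (-1) ^ card S * indicator {..mixed_vertex S x y} w) = (indicator ?B w :: real)" for w
  proof -
    have "indicator {..mixed_vertex S x y} w =
        (\<Prod>i\<in>UNIV. if i \<in> S then of_bool (w $ i \<le> x $ i) else of_bool (w $ i \<le> y $ i) :: real)" for S
    proof -
      have "(\<Prod>i\<in>UNIV. if i \<in> S then of_bool (w $ i \<le> x $ i) else of_bool (w $ i \<le> y $ i)) =
          (\<Prod>i\<in>UNIV. of_bool (w $ i \<le> mixed_vertex S x y $ i) :: real)"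
        by (intro prod.cong) auto
      also have "\<dots> = of_bool (\<forall>i. w $ i \<le> mixed_vertex S x y $ i)"
        by (rule prod_of_bool)
      finally show ?thesis
        by (simp add: indicator_def less_eq_vec_def)
    qed
    then show ?thesis
      using prod_indicator_diff[OF xy, of w] by (simp add: prod_diff_alternating)
  qed
  have "signed_volume (\<lambda>u. measure M {..u}) x y =
      (\<Sum>S\<in>UNIV. \<integral>w. (-1) ^ card S * indicator {..mixed_vertex S x y} w \<partial>M)"
    by (simp add: signed_volume_def space)
  also have "\<dots> = (\<integral>w. (\<Sum>S\<in>UNIV. (-1) ^ card S * indicator {..mixed_vertex S x y} w) \<partial>M)"
    by (rule Bochner_Integration.integral_sum[symmetric])
      (intro integrable_mult_right integrable_real_indicator, auto simp: emeasure_eq_measure)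
  also have "\<dots> = integral\<^sup>L M (indicator ?B)"
    unfolding * ..
  also have "\<dots> = measure M ?B"
    by (simp add: space)
  finally show ?thesis ..
qed

section \<open>Margins and box measures of a law with distribution function \<open>C\<close>\<close>

locale fixed_copula_law = fixed_copula C + prob_space M
  for C :: "real^'k::finite \<Rightarrow> real" and M :: "(real^'k) measure" +
  assumes sets_M [measurable_cong, simp]: "sets M = sets borel"
    and AE_in_cube: "AE x in M. x \<in> cbox 0 1"
    and measure_atMost: "\<And>u. u \<in> cbox 0 1 \<Longrightarrow> measure M {..u} = C u"
begin

lemma space_M [simp]: "space M = UNIV"
  using sets_eq_imp_space_eq[OF sets_M] by simp

text \<open>Clamping \<open>t\<close> preserves the part of the orthant in the cube unless a
  coordinate is negative; then the orthant misses the cube and \<open>C\<close> vanishes at the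
  clamped point.\<close>

lemma emeasure_atMost: "emeasure M {..t} = ennreal (C (clamp01 t))"
proof (cases "\<forall>i. 0 \<le> t $ i")
  case True
  have "emeasure M {..t} = emeasure M {..clamp01 t}"
  proof (rule emeasure_eq_AE)
    show "AE x in M. x \<in> {..t} \<longleftrightarrow> x \<in> {..clamp01 t}"
      using AE_in_cube by eventually_elim (use True in \<open>auto simp: less_eq_vec_def in_unit_cube le_max_iff_disj\<close>)
  qed auto
  then show ?thesis
    by (simp add: emeasure_eq_measure measure_atMost)
next
  case False
  then obtain i where i: "t $ i < 0"
    by (auto simp: not_le)
  have "AE x in M. x \<notin> {..t}"
    using AE_in_cube
  proof eventually_elim
    fix x assume "x \<in> cbox 0 (1 :: real^'k)"
    then have "t $ i < x $ i"
      using i by (auto simp: in_unit_cube less_le_trans)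
    then show "x \<notin> {..t}"
      by (auto simp: less_eq_vec_def not_le)
  qed
  then have "emeasure M {..t} = 0"
    by (subst AE_iff_measurable[symmetric, of _ _ "\<lambda>x. x \<notin> {..t}"]) auto
  moreover have "C (clamp01 t) = 0"
    by (rule copula_eq_0[OF copula, of _ i]) (use i in auto)
  ultimately show ?thesis by simp
qed

lemma measurable_component [measurable]: "(\<lambda>x. x $ i) \<in> borel_measurable M"
  by (subst measurable_cong_sets[OF sets_M refl]) (intro borel_measurable_continuous_onI continuous_intros)

text \<open>With all other coordinates at 1, the distribution function reduces to the margin
  condition of the copula.\<close>

lemma distr_component: "distr M borel (\<lambda>x. x $ i) = uniform_measure lborel {0..1}"
proof -
  note meas = measurable_component[of i]
  interpret D: prob_space "distr M borel (\<lambda>x. x $ i)"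
    by (rule prob_space_distr) simp
  interpret U: prob_space "uniform_measure lborel {0..1::real}"
    by (rule prob_space_uniform_measure) auto
  show ?thesis
  proof (rule cdf_unique)
    show "real_distribution (distr M borel (\<lambda>x. x $ i))" "real_distribution (uniform_measure lborel {0..1})"
      by unfold_locales auto
    show "cdf (distr M borel (\<lambda>x. x $ i)) = cdf (uniform_measure lborel {0..1})"
    proof
      fix t :: real
      let ?u = "\<chi> j. if j = i then t else 1"
      have "cdf (distr M borel (\<lambda>x. x $ i)) t = measure M {x. x $ i \<le> t}"
        unfolding cdf_def by (subst measure_distr) (auto intro!: arg_cong[of _ _ "measure M"])
      also have "\<dots> = measure M {..?u}"
      proof (rule measure_eq_AE)
        show "{x. x $ i \<le> t} \<in> sets M"
          using measurable_sets[OF meas, of "{..t}"] by (simp add: vimage_def)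
        show "AE x in M. x \<in> {x. x $ i \<le> t} \<longleftrightarrow> x \<in> {..?u}"
          using AE_in_cube by eventually_elim (auto simp: less_eq_vec_def in_unit_cube)
      qed simp
      also have "\<dots> = C (clamp01 ?u)"
      proof -
        have "0 \<le> C (clamp01 ?u)"
          using copula clamp01_in_cube[of ?u] by (auto simp: copula_def simp del: clamp01_in_cube)
        then show ?thesis
          by (simp add: measure_def emeasure_atMost)
      qed
      also have "clamp01 ?u = (\<chi> j. if j = i then max 0 (min 1 t) else 1)"
        by (simp add: vec_eq_iff)
      also have "C \<dots> = max 0 (min 1 t)"
        by (rule copula_margin[OF copula]) auto
      also have "\<dots> = cdf (uniform_measure lborel {0..1}) t"
      proof -
        have "{0..1} \<inter> {..t} = {0..min 1 t}" by auto
        then show ?thesis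
          by (simp add: cdf_def max_def)
      qed
      finally show "cdf (distr M borel (\<lambda>x. x $ i)) t = cdf (uniform_measure lborel {0..1}) t" .
    qed
  qed
qed

text \<open>The essential closure argument rests on this; it also makes the faces of boxes
  null.\<close>

lemma null_sets_component:
  assumes N: "N \<in> null_sets lborel"
  shows "{x. x $ i \<in> N} \<in> null_sets M"
proof -
  note meas = measurable_component[of i]
  have sets: "N \<in> sets borel"
    using N by auto
  have "emeasure (distr M borel (\<lambda>x. x $ i)) N = 0"
    using N null_set_Int1[OF N, of "{0..1}"] unfolding distr_component
    by (subst emeasure_uniform_measure) (auto simp: Int_commute)
  then have "emeasure M {x. x $ i \<in> N} = 0"
    by (subst (asm) emeasure_distr[OF meas sets]) (simp add: vimage_def)
  then show ?thesis
    using measurable_sets[OF meas sets] by (auto simp: null_sets_def vimage_def)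
qed

text \<open>The lower faces are null, so the closed box can be replaced by the half-open one, to
  which inclusion-exclusion applies.\<close>

lemma measure_cbox:
  assumes "unit_subbox x y"
  shows "measure M (cbox x y) = box_volume C x y"
proof -
  let ?B = "{w. \<forall>i. x $ i < w $ i \<and> w $ i \<le> y $ i}"
  have xy: "x $ i < y $ i" "0 \<le> x $ i" "y $ i \<le> 1" for i
    using assms by (auto simp: unit_subbox_def)
  have "{w. w $ i = x $ i} \<in> null_sets M" for i
    using null_sets_component[of "{x $ i}" i] by (simp add: countable_imp_null_set_lborel)
  then have "AE w in M. \<forall>i. w $ i \<noteq> x $ i"
    by (auto simp: AE_all_countable intro: AE_I')
  then have "AE w in M. w \<in> cbox x y \<longleftrightarrow> w \<in> ?B"
  proof eventually_elim
    fix w :: "real^'k" assume ne: "\<forall>i. w $ i \<noteq> x $ i"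
    have "x $ i \<le> w $ i \<longleftrightarrow> x $ i < w $ i" for i
      using ne[rule_format, of i] by linarith
    then show "w \<in> cbox x y \<longleftrightarrow> w \<in> ?B"
      by (simp add: mem_box_cart)
  qed
  then have "measure M (cbox x y) = measure M ?B"
  proof (rule measure_eq_AE)
    have "{w \<in> space M. \<forall>i. x $ i < w $ i \<and> w $ i \<le> y $ i} \<in> sets M"
      by measurable
    then show "?B \<in> sets M" by simp
  qed auto
  also have "\<dots> = signed_volume (\<lambda>u. measure M {..u}) x y"
    using xy by (intro measure_half_open_box finite_measure_axioms) (auto intro: less_imp_le)
  also have "\<dots> = signed_volume C x y"
  proof -
    have "mixed_vertex S x y \<in> cbox 0 1" for S
    proof -
      have "x $ i \<le> 1 \<and> 0 \<le> y $ i" for i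
        using xy[of i] by linarith
      with xy show ?thesis
        by (simp add: in_unit_cube)
    qed
    then show ?thesis
      by (simp add: signed_volume_def measure_atMost)
  qed
  also have "\<dots> = box_volume C x y"
    using xy by (simp add: box_volume_eq_signed_volume)
  finally show ?thesis .
qed

lemma is_copula_measure_restrict_space: "is_copula_measure C (restrict_space M (cbox 0 1))"
proof -
  have "emeasure M (cbox 0 1) = 1"
    using AE_in_cube by (intro emeasure_eq_1_AE) auto
  then have "prob_space (restrict_space M (cbox 0 1))"
    by (intro prob_space_restrict_space) auto
  moreover have "measure (restrict_space M (cbox 0 1)) (cbox x y) = box_volume C x y" if "unit_subbox x y" for x y
  proof -
    have "cbox x y \<subseteq> cbox 0 1"
    proof
      fix w assume w: "w \<in> cbox x y"
      have "0 \<le> w $ i \<and> w $ i \<le> 1" for i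
        using that[unfolded unit_subbox_def, rule_format, of i] w[unfolded mem_box_cart, rule_format, of i] by linarith
      then show "w \<in> cbox 0 1" by (simp add: in_unit_cube)
    qed
    then show ?thesis
      using measure_cbox[OF that] by (simp add: measure_restrict_space)
  qed
  moreover have "sets (restrict_space M (cbox 0 1)) = sets (restrict_space borel (cbox 0 1))"
    by (rule sets_restrict_space_cong) simp
  ultimately show ?thesis
    by (simp add: is_copula_measure_def)
qed

end

section \<open>Extension to the whole space and uniqueness\<close>

lemma fixed_copula_lawI: "copula C \<Longrightarrow> copula_law C M \<Longrightarrow> fixed_copula_law C M"
  by (auto simp: copula_law_def fixed_copula_law_def fixed_copula_def fixed_copula_law_axioms_def)

lemma copula_law_unique:
  assumes "copula C" "copula_law C M" "copula_law C N"
  shows "M = N"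
proof -
  interpret M: fixed_copula_law C M by (rule fixed_copula_lawI) fact+
  interpret N: fixed_copula_law C N by (rule fixed_copula_lawI) fact+
  show ?thesis
    by (rule borel_measure_eqI_cdf) (auto simp: M.finite_measure_axioms M.emeasure_atMost N.emeasure_atMost)
qed

lemma emeasure_distr_embed_cube:
  fixes N :: "(real^'k::finite) measure"
  assumes sets: "sets N = sets (restrict_space borel (cbox 0 1))" and A: "A \<in> sets borel"
  shows "emeasure (distr N borel (\<lambda>x. x)) A = emeasure N (A \<inter> cbox 0 1)"
proof -
  have "(\<lambda>x. x) \<in> N \<rightarrow>\<^sub>M borel"
    by (subst measurable_cong_sets[OF sets refl]) (rule measurable_restrict_space1, simp)
  moreover have "space N = cbox 0 1"
    using sets_eq_imp_space_eq[OF sets] by (simp add: space_restrict_space)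
  ultimately show ?thesis
    using A by (simp add: emeasure_distr)
qed

text \<open>Box volumes recover the distribution function: every vertex of \<open>cbox 0 u\<close>
  other than \<open>u\<close> has a coordinate 0, where \<open>C\<close> vanishes.\<close>

lemma copula_law_distr:
  fixes C :: "real^'k::finite \<Rightarrow> real"
  assumes C: "copula C" and N: "is_copula_measure C N"
  shows "copula_law C (distr N borel (\<lambda>x. x))"
proof -
  interpret prob_space N
    using N by (simp add: is_copula_measure_def)
  have sets: "sets N = sets (restrict_space borel (cbox 0 1))"
    using N by (simp add: is_copula_measure_def)
  have space: "space N = cbox 0 1"
    using sets_eq_imp_space_eq[OF sets] by (simp add: space_restrict_space)
  have meas: "(\<lambda>x. x) \<in> N \<rightarrow>\<^sub>M borel"
    by (subst measurable_cong_sets[OF sets refl]) (rule measurable_restrict_space1, simp)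
  have box: "measure N (cbox 0 u) = C u" if u: "\<And>i. 0 < u $ i" "\<And>i. u $ i \<le> 1" for u
  proof -
    have "measure N (cbox 0 u) = signed_volume C 0 u"
      using N u by (simp add: is_copula_measure_def unit_subbox_def box_volume_eq_signed_volume)
    also have "\<dots> = (\<Sum>S\<in>{{}}. (-1) ^ card S * C (mixed_vertex S 0 u))"
      unfolding signed_volume_def
    proof (rule sum.mono_neutral_right)
      show "\<forall>S\<in>UNIV - {{}}. (-1) ^ card S * C (mixed_vertex S 0 u) = 0"
      proof
        fix S :: "'k set" assume "S \<in> UNIV - {{}}"
        then obtain i where "i \<in> S" by auto
        then have "C (mixed_vertex S 0 u) = 0"
          using u by (intro copula_eq_0[OF C, of _ i]) (auto simp: in_unit_cube less_imp_le)
        then show "(-1) ^ card S * C (mixed_vertex S 0 u) = 0" by simp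
      qed
    qed auto
    also have "\<dots> = C u"
      by (simp add: mixed_vertex_def)
    finally show ?thesis .
  qed
  have "measure N (cbox 0 u) = C u" if u: "u \<in> cbox 0 1" for u
  proof (cases "\<forall>i. 0 < u $ i")
    case True
    with u show ?thesis by (intro box) (auto simp: in_unit_cube)
  next
    case False
    then obtain i where i: "u $ i = 0"
      using u by (metis in_unit_cube order_le_less)
    \<comment> \<open>\<open>is_copula_measure\<close> says nothing about degenerate boxes, so
      \<open>cbox 0 u\<close> is enclosed in a box of width \<open>min 1 e\<close> in direction
      \<open>i\<close>, whose measure is known from the margin condition.\<close>
    have "measure N (cbox 0 u) \<le> 0 + e" if "0 < e" for e
    proof -
      let ?v = "\<chi> j. if j = i then min 1 e else 1"
      have "measure N (cbox 0 u) \<le> measure N (cbox 0 ?v)"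
      proof (rule finite_measure_mono)
        show "cbox 0 u \<subseteq> cbox 0 ?v"
        proof
          fix w assume w: "w \<in> cbox 0 u"
          have "0 \<le> w $ j \<and> w $ j \<le> u $ j \<and> u $ j \<le> 1" for j
            using u w[unfolded mem_box_cart, rule_format, of j] by (simp add: in_unit_cube)
          moreover from this[of i] have "w $ i = 0"
            using i by linarith
          ultimately have "0 \<le> w $ j \<and> w $ j \<le> (if j = i then min 1 e else 1)" for j
            using that by (cases "j = i") (auto intro: order_trans[of _ "u $ j"])
          then show "w \<in> cbox 0 ?v" by (simp add: mem_box_cart)
        qed
        show "cbox 0 ?v \<in> sets N"
          unfolding sets by (subst sets_restrict_space_iff) (auto simp: mem_box_cart that split: if_splits)
      qed
      also have "\<dots> = min 1 e"
        using that by (subst box) (auto intro!: copula_margin[OF C])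
      finally show ?thesis by simp
    qed
    then have "measure N (cbox 0 u) \<le> 0"
      by (rule field_le_epsilon)
    then show ?thesis
      using copula_eq_0[OF C u i] by (simp add: measure_le_0_iff)
  qed
  moreover have "measure (distr N borel (\<lambda>x. x)) {..u} = measure N (cbox 0 u)" if "u \<in> cbox 0 1" for u
  proof -
    have "{..u} \<inter> cbox 0 1 = cbox 0 u"
    proof (intro set_eqI iffI)
      fix w assume w: "w \<in> cbox 0 u"
      have "0 \<le> w $ i \<and> w $ i \<le> u $ i \<and> w $ i \<le> 1" for i
        using that[unfolded in_unit_cube, rule_format, of i] w[unfolded mem_box_cart, rule_format, of i] by simp
      then show "w \<in> {..u} \<inter> cbox 0 1" by (simp add: in_unit_cube less_eq_vec_def)
    qed (auto simp: mem_box_cart less_eq_vec_def)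
    then show ?thesis
      by (simp add: measure_def emeasure_distr_embed_cube[OF sets])
  qed
  moreover have "AE x in distr N borel (\<lambda>x. x). x \<in> cbox 0 1"
    by (subst AE_distr_iff[OF meas]) (auto simp: space)
  ultimately show ?thesis
    by (auto simp: copula_law_def intro: prob_space_distr[OF meas])
qed

lemma is_copula_measure_unique:
  assumes C: "copula C" and M: "is_copula_measure C M" and N: "is_copula_measure C N"
  shows "M = N"
proof (rule measure_eqI)
  have sets: "sets M = sets (restrict_space borel (cbox 0 1))" "sets N = sets (restrict_space borel (cbox 0 1))"
    using M N by (simp_all add: is_copula_measure_def)
  then show "sets M = sets N" by simp
  have eq: "distr M borel (\<lambda>x. x) = distr N borel (\<lambda>x. x)"
    by (rule copula_law_unique[OF C]) (intro copula_law_distr C M N)+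
  fix A assume "A \<in> sets M"
  then have A: "A \<in> sets borel" "A \<inter> cbox 0 1 = A"
    unfolding sets by (auto simp: sets_restrict_space_iff)
  have "emeasure (distr M borel (\<lambda>x. x)) A = emeasure (distr N borel (\<lambda>x. x)) A"
    by (simp add: eq)
  then show "emeasure M A = emeasure N A"
    by (simp add: emeasure_distr_embed_cube[OF sets(1) A(1)] emeasure_distr_embed_cube[OF sets(2) A(1)] A(2))
qed

text \<open>Justifies the definite description behind \<open>copula_measure\<close>, with the limit
  law restricted to the cube as witness.\<close>

lemma is_copula_measure_copula_measure:
  assumes "copula C"
  shows "is_copula_measure C (copula_measure C)"
proof -
  interpret fixed_copula C by standard fact
  interpret fixed_copula_law C limit_law
    by (rule fixed_copula_lawI[OF assms copula_law_limit_law])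
  have "\<exists>!N. is_copula_measure C N"
    using is_copula_measure_restrict_space is_copula_measure_unique[OF assms] by blast
  then show ?thesis
    unfolding copula_measure_def by (rule theI')
qed

section \<open>The support is essentially closed\<close>

text \<open>Written as the span of an image so that it matches \<open>standard_subspace\<close>
  literally, with index set \<open>{i}\<close>.\<close>

definition coordinate_axis :: "'k::finite \<Rightarrow> (real^'k) set" where
  "coordinate_axis i = span ((\<lambda>j. axis j 1) ` {i})"

lemma coordinate_axis_eq: "coordinate_axis i = range (\<lambda>c. c *\<^sub>R axis i 1)"
  by (simp add: coordinate_axis_def span_singleton)

lemma standard_subspace_coordinate_axis: "standard_subspace (coordinate_axis i)"
  unfolding standard_subspace_def coordinate_axis_def by blast

lemma dim_coordinate_axis: "dim (coordinate_axis i) = 1"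
  by (simp add: coordinate_axis_def dim_span)

lemma subspace_coords_coordinate_axis: "subspace_coords (coordinate_axis i) = {i}"
proof -
  have "axis j 1 \<in> coordinate_axis i \<longleftrightarrow> j = i" for j
  proof
    assume "axis j 1 \<in> coordinate_axis i"
    then obtain c :: real where "axis j 1 = (c *\<^sub>R axis i 1 :: real^'a)"
      by (auto simp: coordinate_axis_eq)
    then have "(axis j 1 :: real^'a) $ j = (c *\<^sub>R axis i 1) $ j"
      by simp
    then show "j = i"
      by (simp add: axis_def split: if_splits)
  next
    assume "j = i"
    then show "axis j 1 \<in> coordinate_axis i"
      by (auto simp: coordinate_axis_eq intro: image_eqI[of _ _ 1])
  qed
  then show ?thesis
    by (simp add: subspace_coords_def)
qed

lemma orth_projection_coordinate_axis: "orth_projection (coordinate_axis i) x = (x $ i) *\<^sub>R axis i 1"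
  unfolding orth_projection_def
  by (rule the_equality)
    (auto simp: coordinate_axis_eq orthogonal_def inner_diff_left inner_axis inner_axis_axis)

text \<open>The outer measure is attained on a measurable cover, which is carried over to the line
  by identifying a product over one index with its factor.\<close>

lemma subspace_outer_lebesgue_coordinate_axis_eq_0:
  fixes S :: "(real^'k::finite) set"
  assumes "subspace_outer_lebesgue (coordinate_axis i) (orth_projection (coordinate_axis i) ` S) = 0"
  obtains N where "N \<in> null_sets lborel" "(\<lambda>x. x $ i) ` S \<subseteq> N"
proof -
  define P where "P = (\<Pi>\<^sub>M j\<in>{i}. (lborel :: real measure))"
  define r :: "real \<Rightarrow> 'k \<Rightarrow> real" where "r t = (\<lambda>j\<in>{i}. t)" for t
  interpret product_sigma_finite "\<lambda>_::'k. lborel :: real measure"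
    by standard
  have "outer_measure_of P ((\<lambda>x. r (x $ i)) ` S) = 0"
  proof -
    have "restrict (\<lambda>j. ((x $ i) *\<^sub>R axis i 1 :: real^'k) $ j) {i} = r (x $ i)" for x :: "real^'k"
      by (auto simp: r_def restrict_def)
    with assms show ?thesis
      by (simp add: subspace_outer_lebesgue_def subspace_coords_coordinate_axis
          orth_projection_coordinate_axis image_image P_def)
  qed
  moreover have "(\<lambda>x. r (x $ i)) ` S \<subseteq> space P"
    by (auto simp: P_def r_def space_PiM PiE_iff extensional_def split: if_splits)
  ultimately obtain E where E: "E \<in> sets P" "(\<lambda>x. r (x $ i)) ` S \<subseteq> E" "emeasure P E = 0"
    using outer_measure_of_attain[of "(\<lambda>x. r (x $ i)) ` S" P] by auto
  have r: "r \<in> lborel \<rightarrow>\<^sub>M P"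
    unfolding r_def P_def by (intro measurable_restrict) simp
  have sets: "r -` E \<in> sets lborel"
    using measurable_sets[OF r E(1)] by simp
  have "emeasure lborel (r -` E) = emeasure (distr P lborel (\<lambda>f. f i)) (r -` E)"
    using distr_singleton[of i] by (simp add: P_def)
  also have "\<dots> = emeasure P ((\<lambda>f. f i) -` (r -` E) \<inter> space P)"
    using sets by (intro emeasure_distr) (auto simp: P_def intro: measurable_component_singleton)
  also have "\<dots> \<le> emeasure P E"
  proof (rule emeasure_mono)
    \<comment> \<open>On \<open>space P\<close> the map \<open>r\<close> inverts evaluation at
      \<open>i\<close>.\<close>
    have "r (f i) = f" if "f \<in> space P" for f
      using that by (auto simp: P_def r_def space_PiM PiE_def extensional_def restrict_def fun_eq_iff)
    then show "(\<lambda>f. f i) -` (r -` E) \<inter> space P \<subseteq> E"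
      by auto
  qed fact
  finally have "r -` E \<in> null_sets lborel"
    using sets E(3) by (auto simp: null_sets_def)
  then show ?thesis
    using E(2) by (intro that) auto
qed

section \<open>Null complement of the support and the two inclusions\<close>

text \<open>The complement is the union of all open null sets, and countably many of them have the
  same union.\<close>

lemma null_sets_Compl_support:
  fixes M :: "'a::second_countable_topology measure"
  assumes "sets M = sets borel"
  shows "- {x. \<forall>G. open G \<and> x \<in> G \<longrightarrow> emeasure M G > 0} \<in> null_sets M"
proof -
  let ?F = "{G. open G \<and> emeasure M G = 0}"
  obtain F where F: "F \<subseteq> ?F" "countable F" "\<Union>F = \<Union>?F"
    using Lindelof[of ?F] by auto
  have "G \<in> null_sets M" if "G \<in> F" for G
    using that F(1) assms by (auto simp: null_sets_def)
  then have "\<Union>F \<in> null_sets M"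
    using null_sets_UN'[OF F(2), of "\<lambda>G. G"] by simp
  moreover have "- {x. \<forall>G. open G \<and> x \<in> G \<longrightarrow> emeasure M G > 0} = \<Union>?F"
    by (auto simp: not_less)
  ultimately show ?thesis
    using F(3) by simp
qed

lemma copula_support_subset_essential_closure:
  fixes C :: "real^'k::finite \<Rightarrow> real"
  assumes C: "copula C"
  shows "copula_support C \<subseteq> essential_closure 1 (copula_support C)"
proof -
  let ?A = "copula_support C"
  define M where "M = distr (copula_measure C) borel (\<lambda>x. x)"
  have N: "is_copula_measure C (copula_measure C)"
    by (rule is_copula_measure_copula_measure[OF C])
  interpret fixed_copula_law C M
    unfolding M_def by (intro fixed_copula_lawI copula_law_distr C N)
  have "emeasure (copula_measure C) (G \<inter> cbox 0 1) = emeasure M G" if "open G" for G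
    using N that unfolding M_def by (subst emeasure_distr_embed_cube) (auto simp: is_copula_measure_def)
  then have A: "?A = {x. \<forall>G. open G \<and> x \<in> G \<longrightarrow> emeasure M G > 0}"
    unfolding copula_support_def by auto
  have null: "- ?A \<in> null_sets M"
    unfolding A by (rule null_sets_Compl_support) simp
  have pos: "subspace_outer_lebesgue (coordinate_axis i) (orth_projection (coordinate_axis i) ` (G \<inter> ?A)) > 0"
    if x: "x \<in> ?A" and G: "open G" "x \<in> G" for x G i
  proof (rule ccontr)
    assume "\<not> ?thesis"
    then have "subspace_outer_lebesgue (coordinate_axis i) (orth_projection (coordinate_axis i) ` (G \<inter> ?A)) = 0"
      by (simp add: not_less)
    then obtain N where N: "N \<in> null_sets lborel" "(\<lambda>x. x $ i) ` (G \<inter> ?A) \<subseteq> N"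
      by (rule subspace_outer_lebesgue_coordinate_axis_eq_0)
    \<comment> \<open>This set contains \<open>G\<close>: a point of \<open>G\<close> is outside the
      support or has its coordinate \<open>i\<close> in \<open>N\<close>.\<close>
    have "- ?A \<union> {x. x $ i \<in> N} \<in> null_sets M"
      using null null_sets_component[OF N(1)] by (rule null_sets.Un)
    then have "G \<in> null_sets M"
      by (rule null_sets_subset) (use G N(2) in auto)
    then show False
      using x G null_setsD1[of G M] unfolding A by auto
  qed
  \<comment> \<open>Any coordinate axis serves as the required subspace.\<close>
  show ?thesis
    unfolding essential_closure_def
    using pos standard_subspace_coordinate_axis dim_coordinate_axis by blast
qed

text \<open>Positive outer measure forces \<open>G\<close> to meet the support, and \<open>G\<close>
  is then an open neighbourhood of a support point, hence of positive mass.\<close>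

lemma essential_closure_subset_copula_support:
  fixes C :: "real^'k::finite \<Rightarrow> real"
  shows "essential_closure d (copula_support C) \<subseteq> copula_support C"
proof
  fix x assume x: "x \<in> essential_closure d (copula_support C)"
  show "x \<in> copula_support C"
    unfolding copula_support_def
  proof (safe)
    fix G assume G: "open G" "x \<in> G"
    then obtain W where "subspace_outer_lebesgue W (orth_projection W ` (G \<inter> copula_support C)) > 0"
      using x unfolding essential_closure_def by blast
    then have "G \<inter> copula_support C \<noteq> {}"
      by (auto simp: subspace_outer_lebesgue_def)
    then show "0 < emeasure (copula_measure C) (G \<inter> cbox 0 1)"
      using G(1) unfolding copula_support_def by blast
  qed
qed

theorem theorem3p2p1:
  fixes C :: "real^'k::finite \<Rightarrow> real"
  assumes "copula C"
  shows "essentially_closed 1 (copula_support C)"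
  unfolding essentially_closed_def
  using copula_support_subset_essential_closure[OF assms] essential_closure_subset_copula_support
  by blast

end
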